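(* Let $\mathsf{C}$ be a category with an initial object $0$ and $(T,\mu,\eta)$ a monad on $\mathsf{C}$ such that every hom-set of $\mathcal{K}l(T)$ is a complete join-semilattice and Kleisli composition preserves all non-empty joins in each argument. Assume $\perp=\perp\cdot f^\sharp$ for every $f:X\to Y$ in $\mathsf{C}$. For $\alpha:X\multimap X$ let $\alpha^{*}=\bigvee_{n\ge 0}\alpha^{n}$ and $\mathrm{tr}_\alpha=\mu x.(x\cdot\alpha)=\bigvee_{n\in\mathbb{N}}\perp\cdot\alpha^{n}:X\multimap 0$. Then (1) every strong bisimulation on the $T$-coalgebra $\alpha:X\to TX$ is a weak bisimulation on $\alpha$, and (2) $\mathrm{tr}_\alpha=\mathrm{tr}_{\alpha^{*}}$.
   Context: $\mathcal{K}l(T)$: objects of $\mathsf{C}$, morphisms $X\multimap Y$ are $\mathsf{C}$-morphisms $X\to TY$, composition $g\cdot f=\mu_Z\circ Tg\circ f$, identities $1_X=\eta_X$, $\alpha^0=1_X$; $f^\sharp=\eta_Y\circ f$. $\perp$ denotes the least element of a hom-set. A (strong) bisimulation on a $T$-coalgebra $\alpha:X\to TX$ is a kernel bisimulation: a jointly monic span $X\xleftarrow{\pi_1}R\xrightarrow{\pi_2}X$ such that there exist a $T$-coalgebra $\gamma:Z\to TZ$ and two coalgebra homomorphisms $f,g$ from $\alpha$ to $\gamma$ (i.e. $Tf\circ\alpha=\gamma\circ f$, $Tg\circ\alpha=\gamma\circ g$) with $(R,\pi_1,\pi_2)$ the pullback of $X\xrightarrow{f}Z\xleftarrow{g}X$.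 A weak bisimulation on $\alpha$ is a bisimulation on the saturated coalgebra $\alpha^*:X\to TX$. *)

theory Defs
  imports "HOL-Algebra.Complete_Lattice"
begin

text \<open>
  Composition, like the arrow part of a functor, takes the objects involved as arguments:
  \<open>Comp C X Y Z g f\<close> is the composite of \<open>f : X \<rightarrow> Y\<close> and \<open>g : Y \<rightarrow> Z\<close>. Hom-sets are
  therefore not required to be disjoint, so that \<open>X \<rightarrow> T Y\<close> itself can serve as the Kleisli
  hom-set from \<open>X\<close> to \<open>Y\<close> even if \<open>T\<close> is not injective on objects.
\<close>

record ('o, 'm) cat =
  Obj :: "'o set"
  Hom :: "'o \<Rightarrow> 'o \<Rightarrow> 'm set"
  Comp :: "'o \<Rightarrow> 'o \<Rightarrow> 'o \<Rightarrow> 'm \<Rightarrow> 'm \<Rightarrow> 'm"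
  Ident :: "'o \<Rightarrow> 'm"

locale category =
  fixes C :: "('o, 'm, 'x) cat_scheme"
  assumes ident_hom: "X \<in> Obj C \<Longrightarrow> Ident C X \<in> Hom C X X"
    and comp_hom:
      "\<lbrakk>X \<in> Obj C; Y \<in> Obj C; Z \<in> Obj C; f \<in> Hom C X Y; g \<in> Hom C Y Z\<rbrakk>
        \<Longrightarrow> Comp C X Y Z g f \<in> Hom C X Z"
    and ident_left:
      "\<lbrakk>X \<in> Obj C; Y \<in> Obj C; f \<in> Hom C X Y\<rbrakk> \<Longrightarrow> Comp C X Y Y (Ident C Y) f = f"
    and ident_right:
      "\<lbrakk>X \<in> Obj C; Y \<in> Obj C; f \<in> Hom C X Y\<rbrakk> \<Longrightarrow> Comp C X X Y f (Ident C X) = f"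
    and comp_assoc:
      "\<lbrakk>W \<in> Obj C; X \<in> Obj C; Y \<in> Obj C; Z \<in> Obj C;
        f \<in> Hom C W X; g \<in> Hom C X Y; h \<in> Hom C Y Z\<rbrakk>
        \<Longrightarrow> Comp C W Y Z h (Comp C W X Y g f) = Comp C W X Z (Comp C X Y Z h g) f"

primrec cat_power :: "('o, 'm, 'x) cat_scheme \<Rightarrow> 'o \<Rightarrow> 'm \<Rightarrow> nat \<Rightarrow> 'm" where
  "cat_power C X a 0 = Ident C X"
| "cat_power C X a (Suc n) = Comp C X X X a (cat_power C X a n)"

definition initial_object :: "('o, 'm, 'x) cat_scheme \<Rightarrow> 'o \<Rightarrow> bool" where
  "initial_object C I \<longleftrightarrow> I \<in> Obj C \<and> (\<forall>X\<in>Obj C. \<exists>!u. u \<in> Hom C I X)"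

definition jointly_monic ::
    "('o, 'm, 'x) cat_scheme \<Rightarrow> 'o \<Rightarrow> 'o \<Rightarrow> 'o \<Rightarrow> 'm \<Rightarrow> 'm \<Rightarrow> bool" where
  "jointly_monic C R X Y p q \<longleftrightarrow>
     (\<forall>Q\<in>Obj C. \<forall>u\<in>Hom C Q R. \<forall>v\<in>Hom C Q R.
        Comp C Q R X p u = Comp C Q R X p v \<and> Comp C Q R Y q u = Comp C Q R Y q v
        \<longrightarrow> u = v)"

definition is_pullback ::
    "('o, 'm, 'x) cat_scheme \<Rightarrow> 'o \<Rightarrow> 'o \<Rightarrow> 'o \<Rightarrow> 'm \<Rightarrow> 'm \<Rightarrow> 'o \<Rightarrow> 'm \<Rightarrow> 'm \<Rightarrow> bool" where
  "is_pullback C X Y Z f g R p q \<longleftrightarrow>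
     R \<in> Obj C \<and> p \<in> Hom C R X \<and> q \<in> Hom C R Y
     \<and> Comp C R X Z f p = Comp C R Y Z g q
     \<and> (\<forall>Q\<in>Obj C. \<forall>s\<in>Hom C Q X. \<forall>t\<in>Hom C Q Y.
          Comp C Q X Z f s = Comp C Q Y Z g t
          \<longrightarrow> (\<exists>!u. u \<in> Hom C Q R \<and> Comp C Q R X p u = s \<and> Comp C Q R Y q u = t))"

record ('o, 'm) monad_data =
  TObj :: "'o \<Rightarrow> 'o"
  TMap :: "'o \<Rightarrow> 'o \<Rightarrow> 'm \<Rightarrow> 'm"
  eta :: "'o \<Rightarrow> 'm"
  mu :: "'o \<Rightarrow> 'm"

locale monad = category C
  for C :: "('o, 'm, 'x) cat_scheme" +
  fixes T :: "('o, 'm, 'y) monad_data_scheme"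
  assumes tobj: "X \<in> Obj C \<Longrightarrow> TObj T X \<in> Obj C"
    and tmap_hom:
      "\<lbrakk>X \<in> Obj C; Y \<in> Obj C; f \<in> Hom C X Y\<rbrakk>
        \<Longrightarrow> TMap T X Y f \<in> Hom C (TObj T X) (TObj T Y)"
    and tmap_ident: "X \<in> Obj C \<Longrightarrow> TMap T X X (Ident C X) = Ident C (TObj T X)"
    and tmap_comp:
      "\<lbrakk>X \<in> Obj C; Y \<in> Obj C; Z \<in> Obj C; f \<in> Hom C X Y; g \<in> Hom C Y Z\<rbrakk>
        \<Longrightarrow> TMap T X Z (Comp C X Y Z g f)
            = Comp C (TObj T X) (TObj T Y) (TObj T Z) (TMap T Y Z g) (TMap T X Y f)"
    and eta_hom: "X \<in> Obj C \<Longrightarrow> eta T X \<in> Hom C X (TObj T X)"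
    and eta_natural:
      "\<lbrakk>X \<in> Obj C; Y \<in> Obj C; f \<in> Hom C X Y\<rbrakk>
        \<Longrightarrow> Comp C X (TObj T X) (TObj T Y) (TMap T X Y f) (eta T X)
            = Comp C X Y (TObj T Y) (eta T Y) f"
    and mu_hom: "X \<in> Obj C \<Longrightarrow> mu T X \<in> Hom C (TObj T (TObj T X)) (TObj T X)"
    and mu_natural:
      "\<lbrakk>X \<in> Obj C; Y \<in> Obj C; f \<in> Hom C X Y\<rbrakk>
        \<Longrightarrow> Comp C (TObj T (TObj T X)) (TObj T X) (TObj T Y) (TMap T X Y f) (mu T X)
            = Comp C (TObj T (TObj T X)) (TObj T (TObj T Y)) (TObj T Y) (mu T Y)
                (TMap T (TObj T X) (TObj T Y) (TMap T X Y f))"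
    and mu_eta:
      "X \<in> Obj C \<Longrightarrow>
        Comp C (TObj T X) (TObj T (TObj T X)) (TObj T X) (mu T X) (eta T (TObj T X))
          = Ident C (TObj T X)"
    and mu_tmap_eta:
      "X \<in> Obj C \<Longrightarrow>
        Comp C (TObj T X) (TObj T (TObj T X)) (TObj T X) (mu T X)
          (TMap T X (TObj T X) (eta T X)) = Ident C (TObj T X)"
    and mu_assoc:
      "X \<in> Obj C \<Longrightarrow>
        Comp C (TObj T (TObj T (TObj T X))) (TObj T (TObj T X)) (TObj T X) (mu T X)
          (TMap T (TObj T (TObj T X)) (TObj T X) (mu T X))
        = Comp C (TObj T (TObj T (TObj T X))) (TObj T (TObj T X)) (TObj T X) (mu T X)
            (mu T (TObj T X))"

definition kleisli ::
    "('o, 'm, 'x) cat_scheme \<Rightarrow> ('o, 'm, 'y) monad_data_scheme \<Rightarrow> ('o, 'm) cat" where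
  "kleisli C T =
     \<lparr>Obj = Obj C,
      Hom = (\<lambda>X Y. Hom C X (TObj T Y)),
      Comp = (\<lambda>X Y Z g f.
        Comp C X (TObj T (TObj T Z)) (TObj T Z) (mu T Z)
          (Comp C X (TObj T Y) (TObj T (TObj T Z)) (TMap T Y (TObj T Z) g) f)),
      Ident = eta T\<rparr>"

definition sharp ::
    "('o, 'm, 'x) cat_scheme \<Rightarrow> ('o, 'm, 'y) monad_data_scheme \<Rightarrow> 'o \<Rightarrow> 'o \<Rightarrow> 'm \<Rightarrow> 'm" where
  "sharp C T X Y f = Comp C X Y (TObj T Y) (eta T Y) f"

definition coalgebra_hom ::
    "('o, 'm, 'x) cat_scheme \<Rightarrow> ('o, 'm, 'y) monad_data_scheme
      \<Rightarrow> 'o \<Rightarrow> 'm \<Rightarrow> 'o \<Rightarrow> 'm \<Rightarrow> 'm \<Rightarrow> bool" where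
  "coalgebra_hom C T X \<alpha> Z \<gamma> f \<longleftrightarrow>
     f \<in> Hom C X Z
     \<and> Comp C X (TObj T X) (TObj T Z) (TMap T X Z f) \<alpha> = Comp C X Z (TObj T Z) \<gamma> f"

definition bisimulation ::
    "('o, 'm, 'x) cat_scheme \<Rightarrow> ('o, 'm, 'y) monad_data_scheme
      \<Rightarrow> 'o \<Rightarrow> 'm \<Rightarrow> 'o \<Rightarrow> 'm \<Rightarrow> 'm \<Rightarrow> bool" where
  "bisimulation C T X \<alpha> R p q \<longleftrightarrow>
     R \<in> Obj C \<and> p \<in> Hom C R X \<and> q \<in> Hom C R X \<and> jointly_monic C R X X p q
     \<and> (\<exists>Z\<in>Obj C. \<exists>\<gamma>\<in>Hom C Z (TObj T Z). \<exists>f g.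
          coalgebra_hom C T X \<alpha> Z \<gamma> f \<and> coalgebra_hom C T X \<alpha> Z \<gamma> g
          \<and> is_pullback C X X Z f g R p q)"

text \<open>All joins are required, including the empty one, i.e. a least element.\<close>

locale complete_join_semilattice = partial_order L
  for L :: "('a, 'b) gorder_scheme" (structure) +
  assumes sup_exists: "A \<subseteq> carrier L \<Longrightarrow> \<exists>s. least L s (Upper L A)"

text \<open>The order \<open>leq X Y\<close> on a hom-set depends on the pair of objects \<open>X\<close>, \<open>Y\<close>.\<close>

definition hom_order ::
    "('o, 'm, 'x) cat_scheme \<Rightarrow> ('o \<Rightarrow> 'o \<Rightarrow> 'm \<Rightarrow> 'm \<Rightarrow> bool) \<Rightarrow> 'o \<Rightarrow> 'o \<Rightarrow> 'm gorder" where
  "hom_order K leq X Y = \<lparr>carrier = Hom K X Y, eq = (=), le = leq X Y\<rparr>"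

definition comp_preserves_nonempty_joins ::
    "('o, 'm, 'x) cat_scheme \<Rightarrow> ('o \<Rightarrow> 'o \<Rightarrow> 'm \<Rightarrow> 'm \<Rightarrow> bool) \<Rightarrow> bool" where
  "comp_preserves_nonempty_joins K leq \<longleftrightarrow>
     (\<forall>X\<in>Obj K. \<forall>Y\<in>Obj K. \<forall>Z\<in>Obj K.
        (\<forall>g\<in>Hom K Y Z. \<forall>A. A \<subseteq> Hom K X Y \<and> A \<noteq> {} \<longrightarrow>
           Comp K X Y Z g (\<Squnion>\<^bsub>hom_order K leq X Y\<^esub> A)
             = \<Squnion>\<^bsub>hom_order K leq X Z\<^esub> (Comp K X Y Z g ` A))
        \<and> (\<forall>f\<in>Hom K X Y. \<forall>B. B \<subseteq> Hom K Y Z \<and> B \<noteq> {} \<longrightarrow>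
           Comp K X Y Z (\<Squnion>\<^bsub>hom_order K leq Y Z\<^esub> B) f
             = \<Squnion>\<^bsub>hom_order K leq X Z\<^esub> ((\<lambda>g. Comp K X Y Z g f) ` B)))"

definition saturation ::
    "('o, 'm, 'x) cat_scheme \<Rightarrow> ('o \<Rightarrow> 'o \<Rightarrow> 'm \<Rightarrow> 'm \<Rightarrow> bool) \<Rightarrow> 'o \<Rightarrow> 'm \<Rightarrow> 'm" where
  "saturation K leq X \<alpha> = \<Squnion>\<^bsub>hom_order K leq X X\<^esub> (range (cat_power K X \<alpha>))"

definition trace ::
    "('o, 'm, 'x) cat_scheme \<Rightarrow> ('o \<Rightarrow> 'o \<Rightarrow> 'm \<Rightarrow> 'm \<Rightarrow> bool) \<Rightarrow> 'o \<Rightarrow> 'o \<Rightarrow> 'm \<Rightarrow> 'm" where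
  "trace K leq I X \<alpha> =
     \<Squnion>\<^bsub>hom_order K leq X I\<^esub>
       (range (\<lambda>n. Comp K X X I \<bottom>\<^bsub>hom_order K leq X I\<^esub> (cat_power K X \<alpha> n)))"

definition weak_bisimulation ::
    "('o, 'm, 'x) cat_scheme \<Rightarrow> ('o, 'm, 'y) monad_data_scheme
      \<Rightarrow> ('o \<Rightarrow> 'o \<Rightarrow> 'm \<Rightarrow> 'm \<Rightarrow> bool) \<Rightarrow> 'o \<Rightarrow> 'm \<Rightarrow> 'o \<Rightarrow> 'm \<Rightarrow> 'm \<Rightarrow> bool" where
  "weak_bisimulation C T leq X \<alpha> R p q \<longleftrightarrow>
     bisimulation C T X (saturation (kleisli C T) leq X \<alpha>) R p q"

end

theory Submission
  imports Defs
begin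

text \<open>
  A map \<open>f\<close> is a homomorphism from \<open>\<alpha>\<close> to \<open>\<gamma>\<close> iff \<open>f\<^sup>\<sharp> \<cdot> \<alpha> = \<gamma> \<cdot> f\<^sup>\<sharp>\<close> in the Kleisli category.
  Such an intertwining equation passes to all powers and, since composition preserves nonempty
  joins, to saturations; so the pullback that exhibits a strong bisimulation, taken with
  \<open>\<gamma>\<^sup>*\<close> in place of \<open>\<gamma>\<close>, exhibits a weak one. The trace of \<open>\<alpha>\<close> is the least fixed point of
  precomposition with \<open>\<alpha>\<close>, hence it is also fixed by precomposition with every power of \<open>\<alpha>\<close> and
  with \<open>\<alpha>\<^sup>*\<close>, which gives \<open>tr \<alpha>\<^sup>* \<le> tr \<alpha>\<close>; the converse follows from \<open>\<alpha>\<^sup>n \<le> \<alpha>\<^sup>*\<close>.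
\<close>

section \<open>Joins and the least element in a complete join-semilattice\<close>

context complete_join_semilattice
begin

lemma sup_least_Upper:
  assumes "A \<subseteq> carrier L"
  shows "least L (\<Squnion>A) (Upper L A)"
  unfolding sup_def using sup_exists[OF assms] by (rule someI_ex)

lemma sup_in_carrier: "A \<subseteq> carrier L \<Longrightarrow> \<Squnion>A \<in> carrier L"
  using sup_least_Upper least_closed by (metis Upper_closed subsetD least_mem)

lemma le_sup: "A \<subseteq> carrier L \<Longrightarrow> x \<in> A \<Longrightarrow> x \<sqsubseteq> \<Squnion>A"
  by (meson sup_least_Upper least_Upper_above)

lemma sup_le:
  "A \<subseteq> carrier L \<Longrightarrow> z \<in> carrier L \<Longrightarrow> (\<And>x. x \<in> A \<Longrightarrow> x \<sqsubseteq> z) \<Longrightarrow> \<Squnion>A \<sqsubseteq> z"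
  by (meson sup_least_Upper least_le Upper_memI)

lemma bottom_least: "least L \<bottom> (carrier L)"
proof -
  have "\<exists>x. least L x (carrier L)"
    \<comment> \<open>Every element of the carrier is an upper bound of the empty set, so the empty
      join is the least element.\<close>
    using sup_exists[of "{}"] by simp
  then show ?thesis
    unfolding bottom_def by (rule someI_ex)
qed

end

section \<open>Powers of an endomorphism\<close>

context category
begin

lemma cat_power_hom:
  assumes "X \<in> Obj C" "a \<in> Hom C X X"
  shows "cat_power C X a n \<in> Hom C X X"
  by (induction n) (use assms in \<open>auto intro: ident_hom comp_hom\<close>)

text \<open>By induction, \<open>f\<close> is carried past one factor at a time, each
  \<open>a\<close> to its right becoming a \<open>c\<close> to its left. The case
  \<open>Z = X\<close>, \<open>c = f = a\<close> says that \<open>a\<close> commutes with its own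
  powers.\<close>

lemma cat_power_intertwine:
  assumes [simp]: "X \<in> Obj C" "Z \<in> Obj C"
    and a: "a \<in> Hom C X X" and c: "c \<in> Hom C Z Z" and f: "f \<in> Hom C X Z"
    and eq: "Comp C X X Z f a = Comp C X Z Z c f"
  shows "Comp C X X Z f (cat_power C X a n) = Comp C X Z Z (cat_power C Z c n) f"
proof (induction n)
  case 0
  show ?case using f by (simp add: ident_left ident_right)
next
  case (Suc n)
  note an = cat_power_hom[OF _ a, of n] and cn = cat_power_hom[OF _ c, of n]
  have "Comp C X X Z f (cat_power C X a (Suc n))
      = Comp C X X Z (Comp C X X Z f a) (cat_power C X a n)"
    using a f an by (simp add: comp_assoc)
  also have "\<dots> = Comp C X Z Z c (Comp C X X Z f (cat_power C X a n))"
    using c f an by (simp add: eq comp_assoc)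
  also have "\<dots> = Comp C X Z Z (cat_power C Z c (Suc n)) f"
    using c f cn by (simp add: Suc comp_assoc)
  finally show ?case .
qed

lemma cat_power_Suc_right:
  assumes "X \<in> Obj C" "a \<in> Hom C X X"
  shows "cat_power C X a (Suc n) = Comp C X X X (cat_power C X a n) a"
  using cat_power_intertwine[of X X a a a n] assms by simp

end

section \<open>Categories whose hom-sets have joins, and saturation in them\<close>

text \<open>Saturation and trace depend only on composition and on joins in hom-sets, so they are
  studied here without reference to the monad; the Kleisli category is the intended
  instance.\<close>

locale join_enriched_category = category K
  for K :: "('o, 'm, 'x) cat_scheme" +
  fixes leq :: "'o \<Rightarrow> 'o \<Rightarrow> 'm \<Rightarrow> 'm \<Rightarrow> bool"
  assumes hom_complete:
      "\<lbrakk>X \<in> Obj K; Y \<in> Obj K\<rbrakk> \<Longrightarrow> complete_join_semilattice (hom_order K leq X Y)"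
    and comp_joins: "comp_preserves_nonempty_joins K leq"
begin

abbreviation Join :: "'o \<Rightarrow> 'o \<Rightarrow> 'm set \<Rightarrow> 'm" where
  "Join X Y A \<equiv> \<Squnion>\<^bsub>hom_order K leq X Y\<^esub> A"

abbreviation Bot :: "'o \<Rightarrow> 'o \<Rightarrow> 'm" where
  "Bot X Y \<equiv> \<bottom>\<^bsub>hom_order K leq X Y\<^esub>"

lemma carrier_hom_order [simp]: "carrier (hom_order K leq X Y) = Hom K X Y"
  and le_hom_order [simp]: "le (hom_order K leq X Y) = leq X Y"
  and eq_hom_order [simp]: "eq (hom_order K leq X Y) = (=)"
  by (simp_all add: hom_order_def)

context
  fixes X Y
  assumes X [simp]: "X \<in> Obj K" and Y [simp]: "Y \<in> Obj K"
begin

interpretation L: complete_join_semilattice "hom_order K leq X Y"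
  by (rule hom_complete) simp_all

lemma leq_refl: "f \<in> Hom K X Y \<Longrightarrow> leq X Y f f"
  using L.le_refl by simp

lemma leq_trans:
  "\<lbrakk>leq X Y f g; leq X Y g h; f \<in> Hom K X Y; g \<in> Hom K X Y; h \<in> Hom K X Y\<rbrakk> \<Longrightarrow> leq X Y f h"
  using L.le_trans[of f g h] by simp

lemma leq_antisym:
  "\<lbrakk>leq X Y f g; leq X Y g f; f \<in> Hom K X Y; g \<in> Hom K X Y\<rbrakk> \<Longrightarrow> f = g"
  using L.le_antisym[of f g] by simp

lemma Join_hom: "A \<subseteq> Hom K X Y \<Longrightarrow> Join X Y A \<in> Hom K X Y"
  using L.sup_in_carrier by simp

lemma leq_Join: "A \<subseteq> Hom K X Y \<Longrightarrow> f \<in> A \<Longrightarrow> leq X Y f (Join X Y A)"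
  using L.le_sup by simp

lemma Join_leq:
  "\<lbrakk>A \<subseteq> Hom K X Y; g \<in> Hom K X Y; \<And>f. f \<in> A \<Longrightarrow> leq X Y f g\<rbrakk> \<Longrightarrow> leq X Y (Join X Y A) g"
  using L.sup_le by simp

lemma Bot_hom: "Bot X Y \<in> Hom K X Y"
  using L.bottom_least by (simp add: least_def)

lemma Bot_leq: "f \<in> Hom K X Y \<Longrightarrow> leq X Y (Bot X Y) f"
  using L.bottom_least by (simp add: least_def)

end

context
  fixes X Y Z
  assumes obj [simp]: "X \<in> Obj K" "Y \<in> Obj K" "Z \<in> Obj K"
begin

lemma comp_Join:
  "\<lbrakk>g \<in> Hom K Y Z; A \<subseteq> Hom K X Y; A \<noteq> {}\<rbrakk>
    \<Longrightarrow> Comp K X Y Z g (Join X Y A) = Join X Z (Comp K X Y Z g ` A)"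
  using comp_joins obj unfolding comp_preserves_nonempty_joins_def by blast

lemma Join_comp:
  "\<lbrakk>f \<in> Hom K X Y; B \<subseteq> Hom K Y Z; B \<noteq> {}\<rbrakk>
    \<Longrightarrow> Comp K X Y Z (Join Y Z B) f = Join X Z ((\<lambda>g. Comp K X Y Z g f) ` B)"
  using comp_joins obj unfolding comp_preserves_nonempty_joins_def by blast

text \<open>Monotonicity comes from join preservation: \<open>g\<close> below \<open>h\<close> means
  that \<open>h\<close> is the join of \<open>{g, h}\<close>, and precomposition with
  \<open>f\<close> preserves this nonempty join.\<close>

lemma comp_mono_left:
  assumes f: "f \<in> Hom K X Y" and g: "g \<in> Hom K Y Z" "h \<in> Hom K Y Z" and le: "leq Y Z g h"
  shows "leq X Z (Comp K X Y Z g f) (Comp K X Y Z h f)"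
proof -
  have "Join Y Z {g, h} = h"
    using g le by (intro leq_antisym[of Y Z] Join_leq leq_Join Join_hom) (auto intro: leq_refl)
  then have "Comp K X Y Z h f = Join X Z {Comp K X Y Z g f, Comp K X Y Z h f}"
    using Join_comp[of f "{g, h}"] f g by simp
  moreover have "leq X Z (Comp K X Y Z g f) (Join X Z {Comp K X Y Z g f, Comp K X Y Z h f})"
    using f g by (intro leq_Join) (auto intro: comp_hom)
  ultimately show ?thesis by simp
qed

end

context
  fixes X a
  assumes X [simp]: "X \<in> Obj K" and a: "a \<in> Hom K X X"
begin

lemma range_cat_power_hom: "range (cat_power K X a) \<subseteq> Hom K X X"
  using cat_power_hom[OF X a] by auto

lemma saturation_hom: "saturation K leq X a \<in> Hom K X X"
  unfolding saturation_def by (intro Join_hom range_cat_power_hom X)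

text \<open>Preservation of joins is available because the family of powers is nonempty.\<close>

lemma comp_saturation:
  assumes "Y \<in> Obj K" "f \<in> Hom K X Y"
  shows "Comp K X X Y f (saturation K leq X a)
    = Join X Y (range (\<lambda>n. Comp K X X Y f (cat_power K X a n)))"
  unfolding saturation_def
  using assms range_cat_power_hom by (subst comp_Join) (auto simp: image_image)

lemma saturation_comp:
  assumes "Y \<in> Obj K" "f \<in> Hom K Y X"
  shows "Comp K Y X X (saturation K leq X a) f
    = Join Y X (range (\<lambda>n. Comp K Y X X (cat_power K X a n) f))"
  unfolding saturation_def
  using assms range_cat_power_hom by (subst Join_comp) (auto simp: image_image)

end

text \<open>Distributing \<open>f\<close> over both saturations gives two joins of families indexed
  by the exponent, and these families agree term by term.\<close>

lemma saturation_intertwine: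
  assumes "X \<in> Obj K" "Z \<in> Obj K" "a \<in> Hom K X X" "c \<in> Hom K Z Z" "f \<in> Hom K X Z"
    and "Comp K X X Z f a = Comp K X Z Z c f"
  shows "Comp K X X Z f (saturation K leq X a) = Comp K X Z Z (saturation K leq Z c) f"
  using assms by (simp add: comp_saturation saturation_comp cat_power_intertwine[of X Z a c f])

lemma comp_cat_power_fixed:
  assumes "X \<in> Obj K" "Y \<in> Obj K" "a \<in> Hom K X X" "x \<in> Hom K X Y"
    and "Comp K X X Y x a = x"
  shows "Comp K X X Y x (cat_power K X a n) = x"
  using assms by (induction n) (simp_all add: ident_right comp_assoc cat_power_hom)

section \<open>The trace as a least fixed point\<close>

context
  fixes X Y a
  assumes obj [simp]: "X \<in> Obj K" "Y \<in> Obj K" and a: "a \<in> Hom K X X"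
begin

lemma trace_approximants_hom:
  "range (\<lambda>n. Comp K X X Y (Bot X Y) (cat_power K X a n)) \<subseteq> Hom K X Y"
  using a by (auto intro!: comp_hom cat_power_hom Bot_hom)

lemma trace_hom: "trace K leq Y X a \<in> Hom K X Y"
  unfolding trace_def by (intro Join_hom trace_approximants_hom obj)

lemma leq_trace: "leq X Y (Comp K X X Y (Bot X Y) (cat_power K X a n)) (trace K leq Y X a)"
  unfolding trace_def by (intro leq_Join trace_approximants_hom obj) simp

text \<open>Each approximant lies below \<open>x\<close>: replacing the least element by
  \<open>x\<close> can only enlarge the composite, and a fixed \<open>x\<close> absorbs every power
  of \<open>a\<close>.\<close>

lemma trace_leq_fixed:
  assumes x: "x \<in> Hom K X Y" and fixed: "Comp K X X Y x a = x"
  shows "leq X Y (trace K leq Y X a) x"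
  unfolding trace_def
proof (intro Join_leq trace_approximants_hom obj x)
  fix f assume "f \<in> range (\<lambda>n. Comp K X X Y (Bot X Y) (cat_power K X a n))"
  then obtain n where f: "f = Comp K X X Y (Bot X Y) (cat_power K X a n)" by blast
  have "leq X Y f (Comp K X X Y x (cat_power K X a n))"
    unfolding f using x a by (intro comp_mono_left cat_power_hom Bot_hom Bot_leq obj)
  then show "leq X Y f x"
    using comp_cat_power_fixed[OF obj a x fixed] by simp
qed

text \<open>Precomposition with \<open>a\<close> shifts the approximants by one index. The one lost,
  at index 0, is the least element itself, so the join does not change.\<close>

lemma trace_fixed: "Comp K X X Y (trace K leq Y X a) a = trace K leq Y X a"
proof -
  let ?t = "\<lambda>n. Comp K X X Y (Bot X Y) (cat_power K X a n)"
  note t = trace_approximants_hom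
  \<comment> \<open>\<open>cat_power\<close> puts the new factor on the left, but here
    \<open>a\<close> arrives on the right; the powers of \<open>a\<close> commute with
    \<open>a\<close>.\<close>
  have shift: "Comp K X X Y (?t n) a = ?t (Suc n)" for n
    using a cat_power_hom[OF _ a, of n] Bot_hom[of X Y]
    by (simp add: cat_power_Suc_right comp_assoc del: cat_power.simps)
  have eq: "Comp K X X Y (trace K leq Y X a) a = Join X Y (range (\<lambda>n. ?t (Suc n)))"
    unfolding trace_def using a t by (subst Join_comp) (auto simp: image_image shift)
  have t': "range (\<lambda>n. ?t (Suc n)) \<subseteq> Hom K X Y"
    using t by blast
  have "leq X Y (?t n) (Join X Y (range (\<lambda>n. ?t (Suc n))))" for n
  proof (cases n)
    case 0
    then show ?thesis
      using t' Bot_hom[of X Y] by (simp add: ident_right Bot_leq Join_hom)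
  next
    case (Suc m)
    show ?thesis unfolding Suc by (intro leq_Join t' obj) blast
  qed
  then have "leq X Y (trace K leq Y X a) (Join X Y (range (\<lambda>n. ?t (Suc n))))"
    unfolding trace_def using t t' by (intro Join_leq Join_hom obj) auto
  moreover have "leq X Y (Join X Y (range (\<lambda>n. ?t (Suc n)))) (trace K leq Y X a)"
    using t' trace_hom leq_trace by (intro Join_leq obj) blast+
  ultimately show ?thesis
    unfolding eq using t' trace_hom by (intro leq_antisym[of X Y] Join_hom) auto
qed

lemma trace_least_fixed_point:
  "least (hom_order K leq X Y) (trace K leq Y X a)
     (fps (hom_order K leq X Y) (\<lambda>x. Comp K X X Y x a))"
  by (auto simp: least_def fps_def trace_hom trace_fixed trace_leq_fixed)

end

lemma trace_saturation:
  assumes X: "X \<in> Obj K" and Y: "Y \<in> Obj K" and a: "a \<in> Hom K X X"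
  shows "trace K leq Y X (saturation K leq X a) = trace K leq Y X a"
proof (rule leq_antisym[OF X Y])
  let ?s = "saturation K leq X a"
  note s = saturation_hom[OF X a]
  note tr = trace_hom[OF X Y a] and trs = trace_hom[OF X Y s]
  show "trace K leq Y X ?s \<in> Hom K X Y" "trace K leq Y X a \<in> Hom K X Y"
    by (fact trs tr)+
  \<comment> \<open>Since the trace of \<open>a\<close> absorbs every power of \<open>a\<close>, its
    composite with \<open>?s\<close> is a join over a one-element set.\<close>
  have Join_single: "Join X Y {f} = f" if "f \<in> Hom K X Y" for f
    using that X Y by (intro leq_antisym[OF X Y] Join_leq leq_Join Join_hom) (auto intro: leq_refl)
  have "Comp K X X Y (trace K leq Y X a) ?s = trace K leq Y X a"
    using X Y a tr by (simp add: comp_saturation comp_cat_power_fixed trace_fixed Join_single)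
  then show "leq X Y (trace K leq Y X ?s) (trace K leq Y X a)"
    by (intro trace_leq_fixed X Y s tr)
  have B: "Bot X Y \<in> Hom K X Y" by (rule Bot_hom[OF X Y])
  have Bs: "Comp K X X Y (Bot X Y) ?s \<in> Hom K X Y"
    by (rule comp_hom[OF X X Y s B])
  \<comment> \<open>This is the approximant of index 1 of the trace of \<open>?s\<close>.\<close>
  have le: "leq X Y (Comp K X X Y (Bot X Y) ?s) (trace K leq Y X ?s)"
    using leq_trace[OF X Y s, of 1] X s by (simp add: ident_right)
  show "leq X Y (trace K leq Y X a) (trace K leq Y X ?s)"
    unfolding trace_def[of K leq Y X a]
  proof (rule Join_leq[OF X Y trace_approximants_hom[OF X Y a] trs])
    fix f assume f: "f \<in> range (\<lambda>n. Comp K X X Y (Bot X Y) (cat_power K X a n))"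
    \<comment> \<open>Distributivity turns this composite into the join of all approximants of the
      trace of \<open>a\<close>, of which \<open>f\<close> is one.\<close>
    have "leq X Y f (Comp K X X Y (Bot X Y) ?s)"
      unfolding comp_saturation[OF X a Y B]
      using f by (intro leq_Join trace_approximants_hom X Y a)
    then show "leq X Y f (trace K leq Y X ?s)"
      using leq_trans[OF X Y _ le] f trace_approximants_hom[OF X Y a] Bs trs by blast
  qed
qed

end

section \<open>The Kleisli category and coalgebra homomorphisms\<close>

context monad
begin

lemma kleisli_simps:
  "Obj (kleisli C T) = Obj C"
  "Hom (kleisli C T) X Y = Hom C X (TObj T Y)"
  "Ident (kleisli C T) = eta T"
  "Comp (kleisli C T) X Y Z g f
     = Comp C X (TObj T (TObj T Z)) (TObj T Z) (mu T Z)
         (Comp C X (TObj T Y) (TObj T (TObj T Z)) (TMap T Y (TObj T Z) g) f)"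
  by (simp_all add: kleisli_def)

lemma sharp_hom:
  "\<lbrakk>X \<in> Obj C; Y \<in> Obj C; f \<in> Hom C X Y\<rbrakk> \<Longrightarrow> sharp C T X Y f \<in> Hom (kleisli C T) X Y"
  unfolding sharp_def kleisli_simps by (blast intro: comp_hom eta_hom tobj)

text \<open>Naturality of \<open>eta\<close> moves the unit to the outside, where
  \<open>mu_eta\<close> cancels it.\<close>

lemma kleisli_comp_sharp:
  assumes [simp]: "X \<in> Obj C" "Y \<in> Obj C" "Z \<in> Obj C"
    and f: "f \<in> Hom C X Y" and g: "g \<in> Hom C Y (TObj T Z)"
  shows "Comp (kleisli C T) X Y Z g (sharp C T X Y f) = Comp C X Y (TObj T Z) g f"
proof -
  note [simp] = tobj
  note homs = f g eta_hom mu_hom tmap_hom comp_hom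
  have "Comp (kleisli C T) X Y Z g (sharp C T X Y f)
      = Comp C X (TObj T (TObj T Z)) (TObj T Z) (mu T Z)
          (Comp C X Y (TObj T (TObj T Z))
            (Comp C Y (TObj T Y) (TObj T (TObj T Z)) (TMap T Y (TObj T Z) g) (eta T Y)) f)"
    by (simp add: kleisli_simps sharp_def comp_assoc homs)
  also have "\<dots> = Comp C X (TObj T (TObj T Z)) (TObj T Z) (mu T Z)
          (Comp C X (TObj T Z) (TObj T (TObj T Z)) (eta T (TObj T Z)) (Comp C X Y (TObj T Z) g f))"
    by (simp add: eta_natural comp_assoc homs)
  also have "\<dots> = Comp C X Y (TObj T Z) g f"
    by (subst comp_assoc) (simp_all add: mu_eta ident_left homs)
  finally show ?thesis .
qed

text \<open>Functoriality splits off the image of the unit under \<open>T\<close>, and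
  \<open>mu_tmap_eta\<close> cancels it.\<close>

lemma sharp_kleisli_comp:
  assumes [simp]: "X \<in> Obj C" "Y \<in> Obj C" "Z \<in> Obj C"
    and f: "f \<in> Hom C X (TObj T Y)" and g: "g \<in> Hom C Y Z"
  shows "Comp (kleisli C T) X Y Z (sharp C T Y Z g) f
    = Comp C X (TObj T Y) (TObj T Z) (TMap T Y Z g) f"
proof -
  note [simp] = tobj
  note homs = f g eta_hom mu_hom tmap_hom comp_hom
  have "Comp (kleisli C T) X Y Z (sharp C T Y Z g) f
      = Comp C X (TObj T (TObj T Z)) (TObj T Z) (mu T Z)
          (Comp C X (TObj T Z) (TObj T (TObj T Z)) (TMap T Z (TObj T Z) (eta T Z))
            (Comp C X (TObj T Y) (TObj T Z) (TMap T Y Z g) f))"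
    by (simp add: kleisli_simps sharp_def tmap_comp comp_assoc homs)
  also have "\<dots> = Comp C X (TObj T Y) (TObj T Z) (TMap T Y Z g) f"
    by (subst comp_assoc) (simp_all add: mu_tmap_eta ident_left homs)
  finally show ?thesis .
qed

lemma kleisli_category: "category (kleisli C T)"
proof
  fix X assume "X \<in> Obj (kleisli C T)"
  then show "Ident (kleisli C T) X \<in> Hom (kleisli C T) X X"
    by (simp add: kleisli_simps eta_hom)
next
  fix X Y Z f g
  assume "X \<in> Obj (kleisli C T)" "Y \<in> Obj (kleisli C T)" "Z \<in> Obj (kleisli C T)"
    "f \<in> Hom (kleisli C T) X Y" "g \<in> Hom (kleisli C T) Y Z"
  then show "Comp (kleisli C T) X Y Z g f \<in> Hom (kleisli C T) X Z"
    unfolding kleisli_simps by (blast intro: tobj mu_hom tmap_hom comp_hom)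
next
  fix X Y f
  assume "X \<in> Obj (kleisli C T)" "Y \<in> Obj (kleisli C T)" "f \<in> Hom (kleisli C T) X Y"
  then have XY: "X \<in> Obj C" "Y \<in> Obj C" and f: "f \<in> Hom C X (TObj T Y)"
    by (simp_all add: kleisli_simps)
  \<comment> \<open>The Kleisli identity is the sharp of an identity, so both unit laws are
    instances of the two composition formulas for \<open>sharp\<close>.\<close>
  have sharp_ident: "sharp C T Z Z (Ident C Z) = eta T Z" if "Z \<in> Obj C" for Z
    using that by (simp add: sharp_def ident_right tobj eta_hom)
  show "Comp (kleisli C T) X Y Y (Ident (kleisli C T) Y) f = f"
    using sharp_kleisli_comp[OF XY(1,2,2) f ident_hom] XY f
    by (simp add: sharp_ident kleisli_simps(3) tmap_ident ident_left tobj)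
  show "Comp (kleisli C T) X X Y f (Ident (kleisli C T) X) = f"
    using kleisli_comp_sharp[OF XY(1,1,2) ident_hom f] XY f
    by (simp add: sharp_ident kleisli_simps(3) ident_right tobj)
next
  fix W X Y Z f g h
  assume "W \<in> Obj (kleisli C T)" "X \<in> Obj (kleisli C T)" "Y \<in> Obj (kleisli C T)"
    "Z \<in> Obj (kleisli C T)" "f \<in> Hom (kleisli C T) W X" "g \<in> Hom (kleisli C T) X Y"
    "h \<in> Hom (kleisli C T) Y Z"
  then have [simp]: "W \<in> Obj C" "X \<in> Obj C" "Y \<in> Obj C" "Z \<in> Obj C"
    and fgh: "f \<in> Hom C W (TObj T X)" "g \<in> Hom C X (TObj T Y)" "h \<in> Hom C Y (TObj T Z)"
    by (simp_all add: kleisli_simps)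
  note [simp] = tobj
  note homs = fgh eta_hom mu_hom tmap_hom comp_hom
  let ?T = "TObj T"
  let ?gf = "Comp C W (?T X) (?T (?T Y)) (TMap T X (?T Y) g) f"
  let ?Th = "TMap T Y (?T Z) h"
  let ?TTh = "TMap T (?T Y) (?T (?T Z)) ?Th"
  \<comment> \<open>Naturality of \<open>mu\<close> at \<open>h\<close> exchanges \<open>?Th\<close>
    after \<open>mu T Y\<close> for \<open>mu T (?T Z)\<close> after \<open>?TTh\<close>. Then
    \<open>mu_assoc\<close> turns the inner multiplication into the image of \<open>mu T Z\<close>
    under \<open>T\<close>, and functoriality gathers the factors into the Kleisli composite of
    \<open>h\<close> and \<open>g\<close>.\<close>
  have "Comp (kleisli C T) W Y Z h (Comp (kleisli C T) W X Y g f)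
      = Comp C W (?T (?T Z)) (?T Z) (mu T Z)
          (Comp C W (?T (?T Y)) (?T (?T Z))
            (Comp C (?T (?T Y)) (?T Y) (?T (?T Z)) ?Th (mu T Y)) ?gf)"
    by (simp add: kleisli_simps comp_assoc homs)
  also have "\<dots> = Comp C W (?T (?T (?T Z))) (?T Z)
          (Comp C (?T (?T (?T Z))) (?T (?T Z)) (?T Z) (mu T Z) (mu T (?T Z)))
          (Comp C W (?T (?T Y)) (?T (?T (?T Z))) ?TTh ?gf)"
    by (simp add: mu_natural comp_assoc homs)
  also have "\<dots> = Comp C W (?T (?T (?T Z))) (?T Z)
          (Comp C (?T (?T (?T Z))) (?T (?T Z)) (?T Z) (mu T Z) (TMap T (?T (?T Z)) (?T Z) (mu T Z)))
          (Comp C W (?T (?T Y)) (?T (?T (?T Z))) ?TTh ?gf)"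
    by (simp add: mu_assoc)
  also have "\<dots> = Comp (kleisli C T) W X Z (Comp (kleisli C T) X Y Z h g) f"
    by (simp add: kleisli_simps tmap_comp comp_assoc homs)
  finally show "Comp (kleisli C T) W Y Z h (Comp (kleisli C T) W X Y g f)
      = Comp (kleisli C T) W X Z (Comp (kleisli C T) X Y Z h g) f" .
qed

text \<open>Used in both directions: forwards to read a homomorphism as an intertwining equation,
  backwards to recover a homomorphism between the saturated coalgebras.\<close>

lemma coalgebra_hom_iff_kleisli:
  assumes "X \<in> Obj C" "Z \<in> Obj C" "a \<in> Hom C X (TObj T X)" "c \<in> Hom C Z (TObj T Z)"
  shows "coalgebra_hom C T X a Z c f \<longleftrightarrow> f \<in> Hom C X Z \<and>
    Comp (kleisli C T) X X Z (sharp C T X Z f) a = Comp (kleisli C T) X Z Z c (sharp C T X Z f)"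
  using assms unfolding coalgebra_hom_def
  by (metis sharp_kleisli_comp kleisli_comp_sharp)

end

theorem theorem12:
  fixes C :: "('o, 'm) cat"
    and T :: "('o, 'm) monad_data"
    and I :: 'o
    and leq :: "'o \<Rightarrow> 'o \<Rightarrow> 'm \<Rightarrow> 'm \<Rightarrow> bool"
    and X :: 'o
    and \<alpha> :: 'm
  assumes "category C"
    and "initial_object C I"
    and "monad C T"
    and "\<And>Y Z. \<lbrakk>Y \<in> Obj C; Z \<in> Obj C\<rbrakk>
          \<Longrightarrow> complete_join_semilattice (hom_order (kleisli C T) leq Y Z)"
    and "comp_preserves_nonempty_joins (kleisli C T) leq"
    and "\<And>W Y Z f. \<lbrakk>W \<in> Obj C; Y \<in> Obj C; Z \<in> Obj C; f \<in> Hom C W Y\<rbrakk>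
          \<Longrightarrow> \<bottom>\<^bsub>hom_order (kleisli C T) leq W Z\<^esub>
              = Comp (kleisli C T) W Y Z \<bottom>\<^bsub>hom_order (kleisli C T) leq Y Z\<^esub> (sharp C T W Y f)"
    and "X \<in> Obj C"
    and "\<alpha> \<in> Hom (kleisli C T) X X"
  shows "(\<forall>R p q. bisimulation C T X \<alpha> R p q \<longrightarrow> weak_bisimulation C T leq X \<alpha> R p q)
    \<and> least (hom_order (kleisli C T) leq X I) (trace (kleisli C T) leq I X \<alpha>)
        (fps (hom_order (kleisli C T) leq X I) (\<lambda>x. Comp (kleisli C T) X X I x \<alpha>))
    \<and> trace (kleisli C T) leq I X \<alpha>
        = trace (kleisli C T) leq I X (saturation (kleisli C T) leq X \<alpha>)"
proof -
  interpret monad C T by fact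
  let ?K = "kleisli C T"
  interpret K: join_enriched_category ?K leq
    using assms(4,5) kleisli_category
    by (simp add: join_enriched_category_def join_enriched_category_axioms_def kleisli_simps)
  have X: "X \<in> Obj ?K" and I: "I \<in> Obj ?K"
    using assms(2,7) by (simp_all add: kleisli_simps initial_object_def)
  let ?sat = "saturation ?K leq"
  have sat_coalgebra_hom: "coalgebra_hom C T X (?sat X \<alpha>) Z (?sat Z \<gamma>) f"
    if Z: "Z \<in> Obj C" and \<gamma>: "\<gamma> \<in> Hom C Z (TObj T Z)" and f: "coalgebra_hom C T X \<alpha> Z \<gamma> f"
    for Z \<gamma> f
  proof -
    have \<gamma>': "\<gamma> \<in> Hom ?K Z Z" and Z': "Z \<in> Obj ?K"
      using Z \<gamma> by (simp_all add: kleisli_simps)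
    have f': "f \<in> Hom C X Z"
      and eq: "Comp ?K X X Z (sharp C T X Z f) \<alpha> = Comp ?K X Z Z \<gamma> (sharp C T X Z f)"
      using f assms(7,8) Z \<gamma> by (simp_all add: coalgebra_hom_iff_kleisli kleisli_simps(2))
    have "Comp ?K X X Z (sharp C T X Z f) (?sat X \<alpha>) = Comp ?K X Z Z (?sat Z \<gamma>) (sharp C T X Z f)"
      using X Z' assms(8) \<gamma>' sharp_hom[OF assms(7) Z f'] eq by (rule K.saturation_intertwine)
    then show ?thesis
      using K.saturation_hom[OF X assms(8)] K.saturation_hom[OF Z' \<gamma>'] f' assms(7) Z
      by (simp add: coalgebra_hom_iff_kleisli kleisli_simps(2))
  qed
  have sat: "?sat Z \<gamma> \<in> Hom C Z (TObj T Z)" if "Z \<in> Obj C" "\<gamma> \<in> Hom C Z (TObj T Z)" for Z \<gamma>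
    using K.saturation_hom[of Z \<gamma>] that by (simp add: kleisli_simps)
  \<comment> \<open>The witnesses \<open>Z\<close>, \<open>f\<close> and \<open>g\<close> are kept
    and \<open>\<gamma>\<close> is replaced by its saturation. Joint monicity and the pullback
    condition mention neither coalgebra structure, so they carry over unchanged.\<close>
  have "weak_bisimulation C T leq X \<alpha> R p q" if "bisimulation C T X \<alpha> R p q" for R p q
    using that sat_coalgebra_hom sat unfolding weak_bisimulation_def bisimulation_def by meson
  then show ?thesis
    using K.trace_least_fixed_point[OF X I assms(8)] K.trace_saturation[OF X I assms(8)] by simp
qed

end
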